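(* Let $0<p<1$. For every integer $n\ge1$ and every integer $0\le k\le n$ the following bound holds: $$|\delta_n(k,p)|<\min\left\{\frac{1}{\sigma\sqrt{2e}},\ \frac{c_1}{\sigma^2}\right\},$$ where $c_1=0.516$.
   Context: $q=1-p$, $\sigma=\sqrt{npq}$, $\varphi(x)=\frac{1}{\sqrt{2\pi}}e^{-x^2/2}$ is the standard normal density, $P_n(k)=\binom{n}{k}p^kq^{n-k}$, and $\delta_n(k,p)=P_n(k)-\frac{1}{\sqrt{npq}}\,\varphi\left(\frac{k-np}{\sqrt{npq}}\right)$. *)

theory Defs
  imports "HOL-Probability.Probability"
begin

definition binom_sd :: "nat \<Rightarrow> real \<Rightarrow> real" where
  "binom_sd n p = sqrt (real n * p * (1 - p))"

definition binom_prob :: "nat \<Rightarrow> real \<Rightarrow> nat \<Rightarrow> real" where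
  "binom_prob n p k = real (n choose k) * p ^ k * (1 - p) ^ (n - k)"

text \<open>Error of the local normal approximation to the binomial point probability.\<close>

definition local_error :: "nat \<Rightarrow> nat \<Rightarrow> real \<Rightarrow> real" where
  "local_error n k p =
     binom_prob n p k
       - 1 / binom_sd n p * std_normal_density ((real k - real n * p) / binom_sd n p)"

lemma binom_prob_eq_pmf:
  assumes "0 \<le> p" "p \<le> 1"
  shows "binom_prob n p k = pmf (binomial_pmf n p) k"
  using assms by (simp add: binom_prob_def)

end

theory Submission
  imports Defs
begin

text \<open>
  Write \<open>\<sigma>\<close> for the standard deviation. The two bounds coincide at \<open>\<sigma> = 0.516 sqrt (2 e)\<close>, which is
  about \<open>1.203\<close>. Below this value the bound \<open>1 / (\<sigma> sqrt (2 e))\<close> is the smaller one, so the bound by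
  \<open>1 / \<sigma>\<^sup>2\<close> has to be shown only for larger \<open>\<sigma>\<close>.

  The first bound holds separately for the point probability (\<open>binom_prob_less_sd_bound\<close>) and for the
  normal density. For the point probability, maximise over \<open>p\<close> by weighted AM-GM. What remains is a
  product of one weight depending on \<open>k\<close> and the same weight at \<open>n - k\<close>; the weight is
  logarithmically convex, so the worst case is \<open>k = 0\<close>, an elementary estimate of powers.

  The second bound is Fourier inversion. Let \<open>v = p (1 - p)\<close>, let \<open>f\<close> be the characteristic function
  of a centered Bernoulli variable and \<open>g(t) = exp (- v t\<^sup>2 / 2)\<close>. Then \<open>2 \<pi>\<close> times the error is the
  integral of \<open>f\<^sup>n - g\<^sup>n\<close> over \<open>[- \<pi>, \<pi>]\<close> minus that of \<open>g\<^sup>n\<close> over the complement, both against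
  \<open>exp (- i t (k - n p))\<close>. Two estimates hold on \<open>[- \<pi>, \<pi>]\<close>: \<open>\<bar>f - g\<bar> \<le> (11/60) v \<bar>t\<bar>\<^sup>3\<close>
  (\<open>centered_char_gaussian_distance\<close>) and \<open>\<bar>f\<bar> \<le> exp (- v t\<^sup>2 / 5)\<close> (\<open>norm_centered_char_le\<close>).
  Factoring \<open>f\<^sup>n - g\<^sup>n\<close> in the usual way leaves \<open>n\<close> Gaussian integrals of \<open>\<bar>t\<bar>\<^sup>3\<close>, each equal to the
  inverse square of its decay rate. The rates are in arithmetic progression, and the sum of their
  inverse squares is of order \<open>1 / (n v\<^sup>2)\<close> (\<open>sum_inverse_square_arith_le\<close>); multiplied by \<open>v\<close> this
  is the order \<open>1 / \<sigma>\<^sup>2\<close>, and the constants leave room below \<open>0.516\<close>.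
\<close>

section \<open>Uniform bound on the point probabilities\<close>

text \<open>
  Weighted AM-GM in multiplicative form: for the real numbers \<open>x = p (a + b) / a\<close> and
  \<open>y = q (a + b) / b\<close>, the estimate \<open>x \<le> exp (x - 1)\<close> gives \<open>x ^ a * y ^ b \<le> exp 0\<close>. It locates the
  maximum of \<open>p ^ a * q ^ b\<close> at \<open>p = a / (a + b)\<close>.
\<close>

lemma weighted_am_gm_powers:
  fixes p q :: real and a b :: nat
  assumes "0 \<le> p" "0 \<le> q" "p + q = 1" "0 < a" "0 < b"
  shows "p ^ a * q ^ b \<le> real a ^ a * real b ^ b / real (a + b) ^ (a + b)"
proof -
  define x where "x = p * real (a + b) / real a"
  define y where "y = q * real (a + b) / real b"
  have nn: "0 \<le> x" "0 \<le> y" using assms by (auto simp: x_def y_def)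
  have "x ^ a * y ^ b \<le> exp (x - 1) ^ a * exp (y - 1) ^ b"
    using nn exp_ge_add_one_self[of "x - 1"] exp_ge_add_one_self[of "y - 1"]
    by (intro mult_mono power_mono) auto
  also have "\<dots> = exp (real a * (x - 1) + real b * (y - 1))"
    by (simp add: exp_of_nat_mult exp_add)
  also have "real a * (x - 1) + real b * (y - 1) = (p + q) * real (a + b) - real (a + b)"
    using assms(4,5) by (simp add: x_def y_def right_diff_distrib distrib_right)
  finally have "x ^ a * y ^ b \<le> 1" using assms by simp
  moreover have "x ^ a * y ^ b
      = p ^ a * q ^ b * real (a + b) ^ (a + b) / (real a ^ a * real b ^ b)"
    unfolding x_def y_def by (simp add: power_mult_distrib power_divide power_add)
  ultimately have "p ^ a * q ^ b * real (a + b) ^ (a + b) / (real a ^ a * real b ^ b) \<le> 1"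
    by simp
  then show ?thesis using assms by (simp add: field_simps)
qed

text \<open>
  The logarithm of \<open>(k + 1/2)\<^bsup>2k+1\<^esup> / (k!)\<^sup>2\<close>. Once \<open>p\<close> has been eliminated by
  maximisation, two such weights, at \<open>k\<close> and at \<open>n - k\<close>, carry the whole dependence of the squared
  point probability on \<open>k\<close>.
\<close>

definition log_half_weight :: "nat \<Rightarrow> real" where
  "log_half_weight k = (2 * real k + 1) * ln (real k + 1 / 2) - 2 * ln (fact k)"

text \<open>
  Discrete convexity. The increment at \<open>j\<close> is a smooth function of \<open>x = j + 1\<close> whose derivative is
  \<open>2 (ln (x + 1/2) - ln (x - 1/2) - 1 / x)\<close>. This is nonnegative because the average of the convex
  function \<open>1 / t\<close> over an interval of length one is at least its value at the midpoint.
\<close>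

lemma log_half_weight_increment_mono:
  assumes "k \<le> m"
  shows "log_half_weight (Suc k) - log_half_weight k
           \<le> log_half_weight (Suc m) - log_half_weight m"
proof -
  define L :: "real \<Rightarrow> real" where
    "L = (\<lambda>x. (2 * x + 1) * ln (x + 1 / 2) - (2 * x - 1) * ln (x - 1 / 2) - 2 * ln x)"
  have incr: "log_half_weight (Suc j) - log_half_weight j = L (real j + 1)" for j
  proof -
    have "ln (fact (Suc j) :: real) = ln (real j + 1) + ln (fact j)"
      unfolding fact_Suc by (subst ln_mult) (auto simp: add.commute)
    then show ?thesis by (simp add: log_half_weight_def L_def algebra_simps del: fact_Suc)
  qed
  have "L (real k + 1) \<le> L (real m + 1)"
  proof (rule DERIV_nonneg_imp_nondecreasing[where f = L and a = "real k + 1" and b = "real m + 1"])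
    show "real k + 1 \<le> real m + 1" using assms by simp
    fix x assume "real k + 1 \<le> x"
    then have x: "x > 1 / 2" by linarith
    have "(L has_real_derivative
        2 * (ln (x + 1 / 2) - ln (x - 1 / 2)) - 2 / x) (at x)"
    proof -
      have "(L has_real_derivative
          (2 * ln (x + 1 / 2) + (2 * x + 1) / (x + 1 / 2))
          - (2 * ln (x - 1 / 2) + (2 * x - 1) / (x - 1 / 2)) - 2 / x) (at x)"
        unfolding L_def using x by (auto intro!: derivative_eq_intros)
      moreover have "(2 * x + 1) / (x + 1 / 2) = 2" "(2 * x - 1) / (x - 1 / 2) = 2"
        using x by (simp_all add: divide_eq_eq)
      ultimately show ?thesis by (simp add: algebra_simps)
    qed
    moreover have "ln (x + 1 / 2) - ln (x - 1 / 2) \<ge> 1 / x"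
      using ln_inverse_approx_ge[of "x - 1 / 2" "x + 1 / 2"] x by simp
    ultimately show "\<exists>y. DERIV L x :> y \<and> y \<ge> 0" by (intro exI conjI) auto
  qed
  then show ?thesis by (simp only: incr)
qed

text \<open>
  By convexity the product of the weights at \<open>k\<close> and \<open>m\<close> is largest, for a fixed sum, when one of the
  two indices is \<open>0\<close>.
\<close>

lemma log_half_weight_superadditive:
  "log_half_weight k + log_half_weight m \<le> log_half_weight 0 + log_half_weight (k + m)"
proof (induction k)
  case (Suc k)
  then show ?case using log_half_weight_increment_mono[of k "k + m"] by simp
qed simp

lemma exp_log_half_weight:
  "exp (log_half_weight k) = (real k + 1 / 2) ^ (2 * k + 1) / (fact k)\<^sup>2"
proof -
  have "ln ((real k + 1 / 2) ^ (2 * k + 1)) = real (2 * k + 1) * ln (real k + 1 / 2)"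
    by (rule ln_realpow)
  moreover have "ln ((fact k)\<^sup>2 :: real) = 2 * ln (fact k)"
    by (simp add: ln_realpow)
  ultimately have "log_half_weight k = ln ((real k + 1 / 2) ^ (2 * k + 1) / (fact k)\<^sup>2)"
    by (subst ln_div) (auto simp: log_half_weight_def simp del: power_Suc)
  moreover have "0 < (real k + 1 / 2) ^ (2 * k + 1) / (fact k)\<^sup>2"
    by (intro divide_pos_pos zero_less_power) auto
  ultimately show ?thesis by (simp only: exp_ln)
qed

text \<open>
  The squared quantity is \<open>n (n choose k)\<^sup>2 p\<^bsup>2k+1\<^esup> (1 - p)\<^bsup>2(n-k)+1\<^esup>\<close>. Maximising over \<open>p\<close>, and
  then over \<open>k\<close> by superadditivity, leaves the case \<open>k = 0\<close>, where
  \<open>(1 - 1 / (2n + 2))\<^bsup>2n+2\<^esup> \<le> 1 / e\<close> decides. The constant is optimal: it is approached at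
  \<open>k = 0\<close> when \<open>n p = 1/2\<close> and \<open>n\<close> grows.
\<close>

lemma binom_prob_times_sd_square:
  assumes "0 < p" "p < 1" "k \<le> n" "n \<ge> 1"
  shows "(binom_prob n p k * binom_sd n p)\<^sup>2 < 1 / (2 * exp 1)"
proof -
  define m where "m = n - k"
  have n: "n = k + m" using assms by (simp add: m_def)
  define N where "N = real n + 1"
  have N: "N > 1" "real k + 1/2 + (real m + 1/2) = N" using assms by (auto simp: N_def n)
  have scale: "real (2 * j + 1) ^ (2 * j + 1) = 2 ^ (2 * j + 1) * (real j + 1 / 2) ^ (2 * j + 1)" for j
    by (simp add: power_mult_distrib[symmetric] algebra_simps del: power_Suc)
  have am: "p ^ (2 * k + 1) * (1 - p) ^ (2 * m + 1)
      \<le> (real k + 1 / 2) ^ (2 * k + 1) * (real m + 1 / 2) ^ (2 * m + 1) / N ^ (2 * n + 2)"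
  proof -
    have "p ^ (2 * k + 1) * (1 - p) ^ (2 * m + 1)
        \<le> real (2 * k + 1) ^ (2 * k + 1) * real (2 * m + 1) ^ (2 * m + 1)
           / real ((2 * k + 1) + (2 * m + 1)) ^ ((2 * k + 1) + (2 * m + 1))"
      using assms by (intro weighted_am_gm_powers) auto
    also have "real ((2 * k + 1) + (2 * m + 1)) ^ ((2 * k + 1) + (2 * m + 1))
        = 2 ^ (2 * k + 1) * 2 ^ (2 * m + 1) * N ^ (2 * n + 2)"
    proof -
      have "real ((2 * k + 1) + (2 * m + 1)) = 2 * N" by (simp add: N_def n)
      then show ?thesis by (simp add: power_mult_distrib n power_add)
    qed
    also have "real (2 * k + 1) ^ (2 * k + 1) * real (2 * m + 1) ^ (2 * m + 1) / \<dots>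
       = (real k + 1 / 2) ^ (2 * k + 1) * (real m + 1 / 2) ^ (2 * m + 1) / N ^ (2 * n + 2)"
      unfolding scale by simp
    finally show ?thesis .
  qed
  have ch: "real (n choose k) = fact n / (fact k * fact m)"
    using assms by (simp add: binomial_fact m_def)
  have "(binom_prob n p k * binom_sd n p)\<^sup>2
      = real n * (fact n)\<^sup>2 / ((fact k)\<^sup>2 * (fact m)\<^sup>2) * (p ^ (2 * k + 1) * (1 - p) ^ (2 * m + 1))"
    using assms unfolding binom_prob_def binom_sd_def m_def[symmetric] ch
    by (simp add: power_mult_distrib power_divide power_add power_mult[symmetric] mult.commute)
  also have "\<dots> \<le> real n * (fact n)\<^sup>2 / ((fact k)\<^sup>2 * (fact m)\<^sup>2) *
      ((real k + 1 / 2) ^ (2 * k + 1) * (real m + 1 / 2) ^ (2 * m + 1) / N ^ (2 * n + 2))"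
    by (intro mult_left_mono am) auto
  also have "\<dots> = real n * (fact n)\<^sup>2 / N ^ (2 * n + 2) * exp (log_half_weight k + log_half_weight m)"
    by (simp add: exp_add exp_log_half_weight)
  also have "\<dots> \<le> real n * (fact n)\<^sup>2 / N ^ (2 * n + 2) * exp (log_half_weight 0 + log_half_weight (k + m))"
    using N log_half_weight_superadditive by (intro mult_left_mono) auto
  also have "\<dots> = real n / 2 * ((real n + 1 / 2) ^ (2 * n + 1) / N ^ (2 * n + 2))"
    by (simp add: exp_add exp_log_half_weight n)
  also have "(real n + 1 / 2) ^ (2 * n + 1) / N ^ (2 * n + 2)
     = ((real n + 1 / 2) / N) ^ (2 * n + 2) / (real n + 1 / 2)"
  proof -
    have "x ^ (2 * n + 1) / y = x ^ (2 * n + 2) / y / x" if "x > 0" for x y :: real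
      using that by simp
    then show ?thesis unfolding power_divide by simp
  qed
  also have "\<dots> \<le> exp (-1) / (real n + 1 / 2)"
  proof -
    have "((real n + 1 / 2) / N) ^ (2 * n + 2) \<le> exp (- 1 / (2 * N)) ^ (2 * n + 2)"
    proof (rule power_mono)
      have "(real n + 1 / 2) / N = 1 + (- 1 / (2 * N))" using N by (simp add: N_def field_simps)
      also have "\<dots> \<le> exp (- 1 / (2 * N))" by (rule exp_ge_add_one_self)
      finally show "(real n + 1 / 2) / N \<le> exp (- 1 / (2 * N))" .
    qed (use N in auto)
    also have "\<dots> = exp (real (2 * n + 2) * (- 1 / (2 * N)))" by (simp only: exp_of_nat_mult)
    also have "real (2 * n + 2) * (- 1 / (2 * N)) = - 1" using N by (simp add: N_def field_simps)
    finally show ?thesis by (intro divide_right_mono) auto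
  qed
  also have "real n / 2 * (exp (-1) / (real n + 1 / 2)) < 1 / (2 * exp 1)"
  proof -
    have "real n / 2 / (real n + 1 / 2) < 1 / 2" by (simp add: divide_simps)
    then have "exp (- 1) * (real n / 2 / (real n + 1 / 2)) < exp (- 1) * (1 / 2)"
      by (intro mult_strict_left_mono) auto
    moreover have "exp (- 1) * (1 / 2) = 1 / (2 * exp (1 :: real))"
      by (simp add: exp_minus inverse_eq_divide)
    moreover have "real n / 2 * (exp (- 1) / (real n + 1 / 2))
        = exp (- 1) * (real n / 2 / (real n + 1 / 2))" by (simp only: divide_inverse mult_ac)
    ultimately show ?thesis by (simp only:)
  qed
  finally show ?thesis using assms by (simp add: mult_left_mono)
qed

lemma binom_prob_less_sd_bound:
  assumes "0 < p" "p < 1" "n \<ge> 1" "k \<le> n"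
  shows "binom_prob n p k < 1 / (binom_sd n p * sqrt (2 * exp 1))"
proof -
  have sd: "binom_sd n p > 0" using assms by (simp add: binom_sd_def)
  have "binom_prob n p k * binom_sd n p < sqrt (1 / (2 * exp 1))"
    using binom_prob_times_sd_square[OF assms(1,2,4,3)] by (rule real_less_rsqrt)
  then show ?thesis using sd by (simp add: real_sqrt_divide field_simps)
qed

text \<open>
  The error is a difference of two nonnegative numbers, so it suffices to bound each of them; for the
  Gaussian term, \<open>e < \<pi>\<close>.
\<close>

lemma abs_local_error_less_sd_bound:
  assumes "0 < p" "p < 1" "n \<ge> 1" "k \<le> n"
  shows "\<bar>local_error n k p\<bar> < 1 / (binom_sd n p * sqrt (2 * exp 1))"
proof -
  define s where "s = binom_sd n p"
  have s: "s > 0" using assms by (simp add: binom_sd_def s_def)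
  define x where "x = (real k - real n * p) / s"
  have "std_normal_density x \<le> 1 / sqrt (2 * pi)"
    by (simp add: std_normal_density_def field_simps)
  also have "\<dots> < 1 / sqrt (2 * exp 1)"
    using pi_gt3 exp_le by (intro divide_strict_left_mono) (auto intro: mult_pos_pos)
  finally have "1 / s * std_normal_density x < 1 / s * (1 / sqrt (2 * exp 1))"
    using s by (intro mult_strict_left_mono) auto
  moreover have "0 < 1 / s * std_normal_density x"
    using s by (simp add: std_normal_density_def)
  moreover have "0 \<le> binom_prob n p k"
    using assms by (simp add: binom_prob_def)
  ultimately show ?thesis
    using binom_prob_less_sd_bound[OF assms]
    unfolding local_error_def s_def[symmetric] x_def[symmetric] by (simp add: abs_less_iff)
qed

section \<open>Characteristic function of a centered Bernoulli variable\<close>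

lemma bernoulli_variance_le_quarter:
  fixes p :: real
  shows "p * (1 - p) \<le> 1 / 4"
proof -
  have "p * (1 - p) = 1 / 4 - (p - 1 / 2)\<^sup>2" by (simp add: power2_eq_square field_simps)
  then show ?thesis by simp
qed

lemma iexp_minus_quadratic_bound:
  "cmod (iexp x - (1 + \<i> * x - x\<^sup>2 / 2)) \<le> \<bar>x\<bar> ^ 3 / 6"
  using iexp_approx1[of x 2]
  by (simp add: numeral_3_eq_3 numeral_2_eq_2 atMost_Suc fact_numeral algebra_simps power2_eq_square)

text \<open>
  The upper half follows from \<open>1 + x + x\<^sup>2 / 2 \<le> exp x\<close>, because
  \<open>(1 + x + x\<^sup>2 / 2) (1 - x + x\<^sup>2 / 2) = 1 + x\<^sup>4 / 4\<close> is at least \<open>1\<close>.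
\<close>

lemma exp_minus_linear_bound:
  fixes x :: real
  assumes "0 \<le> x"
  shows "\<bar>exp (- x) - (1 - x)\<bar> \<le> x\<^sup>2 / 2"
proof -
  have "exp (- x) \<le> 1 - x + x\<^sup>2 / 2"
  proof -
    have "1 \<le> (1 + x + x\<^sup>2 / 2) * (1 - x + x\<^sup>2 / 2)"
    proof -
      have "(1 + x + x\<^sup>2 / 2) * (1 - x + x\<^sup>2 / 2) = 1 + (x\<^sup>2)\<^sup>2 / 4"
        by (simp add: power2_eq_square field_simps)
      then show ?thesis by simp
    qed
    also have "\<dots> \<le> exp x * (1 - x + x\<^sup>2 / 2)"
    proof (rule mult_right_mono)
      show "1 + x + x\<^sup>2 / 2 \<le> exp x" using exp_lower_Taylor_quadratic[OF assms] by simp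
      have "1 - x + x\<^sup>2 / 2 = ((1 - x)\<^sup>2 + 1) / 2" by (simp add: power2_eq_square field_simps)
      then show "0 \<le> 1 - x + x\<^sup>2 / 2" by (simp only:) simp
    qed
    finally show ?thesis by (simp add: exp_minus field_simps)
  qed
  moreover have "1 - x \<le> exp (- x)" using exp_ge_add_one_self[of "- x"] by simp
  ultimately show ?thesis by simp
qed

text \<open>
  Concavity of the sine on \<open>[0, \<pi>/2]\<close> puts it above the chord, so that
  \<open>1 - cos t = 2 sin\<^sup>2 (t/2) \<ge> 2 t\<^sup>2 / \<pi>\<^sup>2\<close>; the round constant uses \<open>\<pi>\<^sup>2 \<le> 10\<close>.
\<close>

lemma one_minus_cos_ge:
  assumes "\<bar>t\<bar> \<le> pi"
  shows "t\<^sup>2 / 5 \<le> 1 - cos t"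
proof -
  define u where "u = \<bar>t\<bar> / 2"
  have u: "u \<in> {0..pi / 2}" using assms by (auto simp: u_def)
  have "convex_on {0..pi / 2} (\<lambda>x. - sin x)"
    by (rule f''_ge0_imp_convex[where f' = "\<lambda>x. - cos x" and f'' = sin])
       (auto intro!: derivative_eq_intros sin_ge_zero)
  from convex_onD_Icc'[OF this u] have "u * 2 / pi \<le> sin u" by (simp add: mult.commute)
  then have "(u * 2 / pi)\<^sup>2 \<le> (sin u)\<^sup>2" using u by (intro power_mono) auto
  moreover have "t\<^sup>2 / 5 \<le> 2 * (u * 2 / pi)\<^sup>2"
  proof -
    have "pi * pi \<le> 3.15 * 3.15" using pi_approx by (intro mult_mono) auto
    then have "pi\<^sup>2 \<le> 10" by (simp add: power2_eq_square)
    then have "t\<^sup>2 * pi\<^sup>2 \<le> t\<^sup>2 * 10" by (intro mult_left_mono) auto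
    then show ?thesis by (simp add: u_def power_divide power_mult_distrib field_simps)
  qed
  moreover have "1 - cos t = 2 * (sin u)\<^sup>2"
  proof -
    have "cos t = cos (2 * u)" by (simp add: u_def)
    then show ?thesis using cos_double_sin[of u] by simp
  qed
  ultimately show ?thesis by linarith
qed

text \<open>
  The characteristic function of \<open>X - p\<close> for a Bernoulli variable \<open>X\<close> with success probability \<open>p\<close>.
\<close>

definition centered_char :: "real \<Rightarrow> real \<Rightarrow> complex" where
  "centered_char p t = of_real (1 - p) * iexp (- (p * t)) + p * iexp ((1 - p) * t)"

text \<open>
  Exactly, \<open>\<bar>f(t)\<bar>\<^sup>2 = 1 - 2 p (1 - p) (1 - cos t)\<close>. On the whole period this decays like a Gaussian,
  though with the rate \<open>1/5\<close> in place of the limiting rate \<open>1/2\<close>.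
\<close>

lemma norm_centered_char_le:
  assumes "0 < p" "p < 1" "\<bar>t\<bar> \<le> pi"
  shows "cmod (centered_char p t) \<le> exp (- (p * (1 - p) / 5) * t\<^sup>2)"
proof -
  define v where "v = p * (1 - p)"
  have v: "v > 0" using assms by (simp add: v_def)
  have fact: "centered_char p t = iexp (- (p * t)) * ((1 - p) + p * iexp t)"
    by (simp add: centered_char_def algebra_simps mult_exp_exp)
  have "(cmod (centered_char p t))\<^sup>2 = (cmod ((1 - p) + p * iexp t))\<^sup>2"
    by (simp add: fact norm_mult)
  also have "\<dots> = (1 - p + p * cos t)\<^sup>2 + (p * sin t)\<^sup>2"
    by (simp add: cmod_power2 Re_exp Im_exp)
  also have "\<dots> = 1 + - (2 * v * (1 - cos t))"
  proof -
    have "(sin t)\<^sup>2 = 1 - (cos t)\<^sup>2" by (simp add: sin_squared_eq)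
    then show ?thesis unfolding v_def by (simp add: power_mult_distrib) (simp add: power2_eq_square algebra_simps)
  qed
  also have "\<dots> \<le> exp (- (2 * v * (1 - cos t)))" by (rule exp_ge_add_one_self)
  also have "\<dots> \<le> exp (- (2 * v * (t\<^sup>2 / 5)))"
    using mult_left_mono[OF one_minus_cos_ge[OF assms(3)], of "2 * v"] v by simp
  also have "\<dots> = (exp (- (v / 5) * t\<^sup>2))\<^sup>2"
    by (simp add: exp_double[symmetric] field_simps)
  finally show ?thesis unfolding v_def by (rule power2_le_imp_le) simp
qed

text \<open>
  Both functions agree with \<open>1 - p (1 - p) t\<^sup>2 / 2\<close> to second order. With \<open>v = p (1 - p)\<close>, the third
  absolute moment of the centered variable is \<open>v (1 - 2 v)\<close>, which gives \<open>v (1 - 2 v) \<bar>t\<bar>\<^sup>3 / 6\<close> for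
  the characteristic function, and the Gaussian contributes \<open>v\<^sup>2 t\<^sup>4 / 8\<close>. Since \<open>\<bar>t\<bar> \<le> \<pi>\<close> and
  \<open>v \<le> 1/4\<close>, the gain \<open>- 2 v\<close> absorbs the quartic term up to a factor \<open>11/10\<close>.
\<close>

lemma centered_char_gaussian_distance:
  assumes "0 < p" "p < 1" "\<bar>t\<bar> \<le> pi"
  shows "cmod (centered_char p t - exp (- (p * (1 - p) / 2) * t\<^sup>2))
           \<le> 11 / 60 * (p * (1 - p)) * \<bar>t\<bar> ^ 3"
proof -
  define q where "q = 1 - p"
  define v where "v = p * q"
  define x where "x = v / 2 * t\<^sup>2"
  have q: "0 < q" "p + q = 1" using assms by (auto simp: q_def)
  have v: "0 < v" "v \<le> 1 / 4"
    using assms q bernoulli_variance_le_quarter[of p] by (auto simp: v_def q_def)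
  have x: "0 \<le> x" using v by (simp add: x_def)
  (* The linear terms cancel because the variable is centered. *)
  have split: "centered_char p t - (1 - x)
      = q * (iexp (- (p * t)) - (1 + \<i> * of_real (- (p * t)) - (- (p * t))\<^sup>2 / 2))
        + p * (iexp (q * t) - (1 + \<i> * of_real (q * t) - (q * t)\<^sup>2 / 2))"
  proof -
    have "complex_of_real x
        = of_real q * (of_real (- (p * t)))\<^sup>2 / 2 + of_real p * (of_real (q * t))\<^sup>2 / 2"
    proof -
      have "x = (p + q) * (p * q * t\<^sup>2 / 2)" using q by (simp add: x_def v_def)
      also have "\<dots> = q * ((- (p * t))\<^sup>2 / 2) + p * ((q * t)\<^sup>2 / 2)"
        by (simp add: power2_eq_square field_simps)
      finally show ?thesis by simp
    qed
    moreover have "(1::complex) = of_real q + of_real p"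
      using q by (metis add.commute of_real_1 of_real_add)
    ultimately have "1 - complex_of_real x
        = (of_real q + of_real p)
          - (of_real q * (of_real (- (p * t)))\<^sup>2 / 2 + of_real p * (of_real (q * t))\<^sup>2 / 2)"
      by metis
    then have "1 - complex_of_real x
        = of_real q * (1 + \<i> * of_real (- (p * t)) - (of_real (- (p * t)))\<^sup>2 / 2)
          + of_real p * (1 + \<i> * of_real (q * t) - (of_real (q * t))\<^sup>2 / 2)"
      by (simp add: algebra_simps)
    then show ?thesis
      unfolding centered_char_def q_def[symmetric] by (simp add: right_diff_distrib)
  qed
  have "cmod (centered_char p t - (1 - x)) \<le> q * (\<bar>- (p * t)\<bar> ^ 3 / 6) + p * (\<bar>q * t\<bar> ^ 3 / 6)"
    unfolding split
    using iexp_minus_quadratic_bound[of "- (p * t)"] iexp_minus_quadratic_bound[of "q * t"] assms q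
    by (intro norm_triangle_le add_mono) (auto simp: norm_mult intro!: mult_left_mono)
  also have "\<dots> = v / 6 * \<bar>t\<bar> ^ 3 * (p\<^sup>2 + q\<^sup>2)"
    using assms q by (simp add: abs_mult v_def power2_eq_square power3_eq_cube field_simps)
  also have "p\<^sup>2 + q\<^sup>2 = 1 - 2 * v"
    by (simp add: v_def q_def power2_eq_square algebra_simps)
  finally have 1: "cmod (centered_char p t - (1 - x)) \<le> v / 6 * \<bar>t\<bar> ^ 3 * (1 - 2 * v)" .
  have "cmod (complex_of_real (1 - x) - exp (- x)) = \<bar>exp (- x) - (1 - x)\<bar>"
    by (metis norm_minus_commute norm_of_real of_real_diff real_norm_def)
  also have "\<dots> \<le> x\<^sup>2 / 2" by (rule exp_minus_linear_bound[OF x])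
  also have "\<dots> = v / 6 * \<bar>t\<bar> ^ 3 * (3 / 4 * v * \<bar>t\<bar>)"
    by (simp add: x_def power2_eq_square power3_eq_cube abs_if)
  finally have 2: "cmod (complex_of_real (1 - x) - exp (- x)) \<le> v / 6 * \<bar>t\<bar> ^ 3 * (3 / 4 * v * \<bar>t\<bar>)" .
  have "cmod (centered_char p t - exp (- x)) \<le> v / 6 * \<bar>t\<bar> ^ 3 * (1 - 2 * v + 3 / 4 * v * \<bar>t\<bar>)"
    using norm_triangle_ineq[of "centered_char p t - (1 - x)" "complex_of_real (1 - x) - exp (- x)"] 1 2
    by (simp add: distrib_left)
  also have "\<dots> \<le> v / 6 * \<bar>t\<bar> ^ 3 * (11 / 10)"
  proof (rule mult_left_mono)
    have "\<bar>t\<bar> \<le> 3.2" using assms pi_approx by simp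
    then have "v * (3 / 4 * \<bar>t\<bar> - 2) \<le> v * (2 / 5)" using v by (intro mult_left_mono) auto
    also have "\<dots> \<le> 1 / 10" using v by simp
    finally show "1 - 2 * v + 3 / 4 * v * \<bar>t\<bar> \<le> 11 / 10" by (simp add: algebra_simps)
  qed (use v in auto)
  finally show ?thesis by (simp add: x_def v_def q_def)
qed

section \<open>Fourier inversion\<close>

lemma iexp_orthogonality:
  fixes m :: int
  shows "has_bochner_integral lborel
    (\<lambda>t. indicator {- pi..pi} t *\<^sub>R iexp (of_int m * t)) (if m = 0 then of_real (2 * pi) else 0)"
proof (cases "m = 0")
  case True
  have "has_bochner_integral lborel (\<lambda>t. indicator {- pi..pi} t *\<^sub>R (1::complex))
      (of_real pi - of_real (- pi))"
    by (rule has_bochner_integral_FTC_Icc) (auto intro!: derivative_eq_intros)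
  then show ?thesis using True by simp
next
  case False
  define c where "c = \<i> * complex_of_int m"
  have c: "c \<noteq> 0" using False by (simp add: c_def)
  have "has_bochner_integral lborel (\<lambda>t. indicator {- pi..pi} t *\<^sub>R exp (c * complex_of_real t))
      (exp (c * of_real pi) / c - exp (c * of_real (- pi)) / c)"
  proof (rule has_bochner_integral_FTC_Icc)
    fix x :: real
    show "((\<lambda>t. exp (c * complex_of_real t) / c) has_vector_derivative exp (c * complex_of_real x))
        (at x within {- pi..pi})"
      by (rule has_vector_derivative_real_field) (use c in \<open>auto intro!: derivative_eq_intros\<close>)
  qed (auto intro!: continuous_intros)
  moreover have "exp (c * of_real pi) = exp (c * of_real (- pi))"
  proof (rule complex_eqI)
    have "sin (of_int m * pi) = 0" using sin_zero_iff_int2 by blast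
    then show "Im (exp (c * of_real pi)) = Im (exp (c * of_real (- pi)))"
      by (simp add: c_def Im_exp)
  qed (simp add: c_def Re_exp)
  ultimately show ?thesis using False by (simp add: c_def mult.assoc)
qed

text \<open>
  The integrand is the trigonometric polynomial whose coefficients are the point probabilities;
  orthogonality picks out the one at \<open>k\<close>.
\<close>

lemma binom_prob_fourier_inversion:
  assumes "k \<le> n"
  shows "has_bochner_integral lborel
    (\<lambda>t. indicator {- pi..pi} t *\<^sub>R (centered_char p t ^ n * iexp (- (t * (real k - real n * p)))))
    (of_real (2 * pi * binom_prob n p k))"
proof -
  have expand: "centered_char p t ^ n * iexp (- (t * (real k - real n * p)))
      = (\<Sum>j\<le>n. of_real (binom_prob n p j) * iexp (of_int (int j - int k) * t))" for t
  proof -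
    have "centered_char p t = iexp (- (p * t)) * (of_real p * iexp t + of_real (1 - p))"
      by (simp add: centered_char_def algebra_simps mult_exp_exp)
    then have "centered_char p t ^ n = iexp (- (p * t)) ^ n * (of_real p * iexp t + of_real (1 - p)) ^ n"
      by (simp only: power_mult_distrib)
    also have "\<dots> = iexp (- (p * t)) ^ n *
       (\<Sum>j\<le>n. of_nat (n choose j) * (of_real p * iexp t) ^ j * of_real (1 - p) ^ (n - j))"
      by (simp only: binomial_ring)
    finally have "centered_char p t ^ n * iexp (- (t * (real k - real n * p)))
      = (\<Sum>j\<le>n. of_real (binom_prob n p j) *
          (iexp t ^ j * (iexp (- (p * t)) ^ n * iexp (- (t * (real k - real n * p))))))"
      by (simp add: sum_distrib_left sum_distrib_right binom_prob_def power_mult_distrib mult_ac)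
    also have "\<dots> = (\<Sum>j\<le>n. of_real (binom_prob n p j) * iexp (of_int (int j - int k) * t))"
      by (intro sum.cong refl arg_cong2[where f = "(*)"])
         (simp add: exp_of_nat_mult[symmetric] mult_exp_exp algebra_simps)
    finally show ?thesis .
  qed
  have "has_bochner_integral lborel
    (\<lambda>t. \<Sum>j\<le>n. of_real (binom_prob n p j) * (indicator {- pi..pi} t *\<^sub>R iexp (of_int (int j - int k) * t)))
    (\<Sum>j\<le>n. of_real (binom_prob n p j) * (if int j - int k = 0 then of_real (2 * pi) else 0))"
    by (intro has_bochner_integral_sum has_bochner_integral_mult_right iexp_orthogonality)
  moreover have "(\<Sum>j\<le>n. of_real (binom_prob n p j) * (if int j - int k = 0 then of_real (2 * pi) else 0))
      = complex_of_real (2 * pi * binom_prob n p k)"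
  proof -
    have "(\<Sum>j\<le>n. of_real (binom_prob n p j) * (if int j - int k = 0 then of_real (2 * pi) else 0))
      = (\<Sum>j\<le>n. if j = k then complex_of_real (2 * pi * binom_prob n p k) else 0)"
      by (intro sum.cong) auto
    then show ?thesis using assms by simp
  qed
  ultimately show ?thesis
    unfolding expand by (simp add: scaleR_sum_right)
qed

text \<open>
  The Gaussian is its own Fourier transform, so this is the formula for the characteristic function of
  the standard normal law read backwards, after rescaling by \<open>s\<close>.
\<close>

lemma normal_density_fourier_inversion:
  fixes s y :: real
  assumes "s > 0"
  shows "has_bochner_integral lborel
    (\<lambda>t. of_real (exp (- (s\<^sup>2 / 2) * t\<^sup>2)) * iexp (- (t * y)))
    (of_real (2 * pi * (1 / s * std_normal_density (y / s))))"
proof -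
  define u where "u = - (y / s)"
  have "integrable lborel (\<lambda>x. std_normal_density x *\<^sub>R iexp (u * x))"
    by (rule Bochner_Integration.integrable_bound[OF integrable_normal_density[of 1 0]])
       (auto simp: norm_mult)
  moreover have "(CLINT x|lborel. std_normal_density x *\<^sub>R iexp (u * x)) = of_real (exp (- (u\<^sup>2) / 2))"
    using fun_cong[OF char_std_normal_distribution, of u]
    unfolding char_def by (subst (asm) integral_density) auto
  ultimately have "has_bochner_integral lborel (\<lambda>x. std_normal_density x *\<^sub>R iexp (u * x))
      (of_real (exp (- (u\<^sup>2) / 2)))"
    by (simp add: has_bochner_integral_iff)
  then have "has_bochner_integral lborel
      (\<lambda>t. std_normal_density (0 + s * t) *\<^sub>R iexp (u * (0 + s * t))) (of_real (exp (- (u\<^sup>2) / 2)) /\<^sub>R \<bar>s\<bar>)"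
    using assms by (subst (asm) lborel_has_bochner_integral_real_affine_iff[where c = s and t = 0]) auto
  then have "has_bochner_integral lborel
      (\<lambda>t. of_real (sqrt (2 * pi)) * (std_normal_density (0 + s * t) *\<^sub>R iexp (u * (0 + s * t))))
      (of_real (sqrt (2 * pi)) * (of_real (exp (- (u\<^sup>2) / 2)) /\<^sub>R \<bar>s\<bar>) :: complex)"
    by (rule has_bochner_integral_mult_right)
  moreover have "of_real (sqrt (2 * pi)) * (std_normal_density (0 + s * t) *\<^sub>R iexp (u * (0 + s * t)))
     = of_real (exp (- (s\<^sup>2 / 2) * t\<^sup>2)) * iexp (- (t * y))" for t
  proof -
    have "u * (0 + s * t) = - (t * y)" using assms by (simp add: u_def)
    moreover have "sqrt (2 * pi) * std_normal_density (0 + s * t) = exp (- (s\<^sup>2 / 2) * t\<^sup>2)"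
      by (simp add: std_normal_density_def power_mult_distrib)
    ultimately show ?thesis
      by (metis mult.assoc of_real_mult scaleR_conv_of_real)
  qed
  moreover have "of_real (sqrt (2 * pi)) * (of_real (exp (- (u\<^sup>2) / 2)) /\<^sub>R \<bar>s\<bar>)
     = complex_of_real (2 * pi * (1 / s * std_normal_density (y / s)))"
  proof -
    have "2 * pi / sqrt (2 * pi) = sqrt (2 * pi)" by (rule real_div_sqrt) simp
    moreover have "2 * pi * (1 / s * std_normal_density (y / s))
        = 2 * pi / sqrt (2 * pi) * (exp (- (u\<^sup>2) / 2) / s)"
      by (simp add: std_normal_density_def u_def)
    ultimately have "2 * pi * (1 / s * std_normal_density (y / s))
        = sqrt (2 * pi) * (exp (- (u\<^sup>2) / 2) / s)"
      by (simp only:)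
    moreover have "of_real a * (of_real b /\<^sub>R \<bar>s\<bar>) = complex_of_real (a * (b / s))" for a b :: real
      using assms by (simp add: scaleR_conv_of_real divide_inverse)
    ultimately show ?thesis by (simp only:)
  qed
  ultimately show ?thesis by (simp only:)
qed

section \<open>Bound by the reciprocal variance\<close>

text \<open>
  Every error term below is at most \<open>\<bar>t\<bar>\<^sup>3\<close> times a Gaussian, so all error bounds reduce to
  this moment.
\<close>

lemma has_bochner_integral_abs_cube_gaussian:
  fixes \<alpha> :: real
  assumes "\<alpha> > 0"
  shows "has_bochner_integral lborel (\<lambda>t. \<bar>t\<bar> ^ 3 * exp (- \<alpha> * t\<^sup>2)) (1 / \<alpha>\<^sup>2)"
proof -
  define s where "s = 1 / sqrt (2 * \<alpha>)"
  have s: "s > 0" "s\<^sup>2 = 1 / (2 * \<alpha>)" using assms by (auto simp: s_def power_divide)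
  have "has_bochner_integral lborel (\<lambda>t. sqrt (2 * pi) * s * (normal_density 0 s t * \<bar>t - 0\<bar> ^ (2 * 1 + 1)))
      (sqrt (2 * pi) * s * (2 ^ 1 * s ^ (2 * 1 + 1) * fact 1 * sqrt (2 / pi)))"
    by (intro has_bochner_integral_mult_right normal_moment_abs_odd s)
  moreover have "sqrt (2 * pi) * s * (normal_density 0 s t * \<bar>t - 0\<bar> ^ (2 * 1 + 1))
      = \<bar>t\<bar> ^ 3 * exp (- \<alpha> * t\<^sup>2)" for t
  proof -
    have "t\<^sup>2 / (2 * s\<^sup>2) = \<alpha> * t\<^sup>2" using assms s by simp
    moreover have "sqrt (2 * pi * s\<^sup>2) = sqrt (2 * pi) * s"
      using s(1) by (simp add: real_sqrt_mult)
    ultimately show ?thesis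
      using s(1) by (simp add: normal_density_def)
  qed
  moreover have "sqrt (2 * pi) * s * (2 ^ 1 * s ^ (2 * 1 + 1) * fact 1 * sqrt (2 / pi)) = 1 / \<alpha>\<^sup>2"
  proof -
    have "sqrt (2 * pi) * sqrt (2 / pi) = 2"
      by (simp add: real_sqrt_mult[symmetric])
    moreover have "sqrt (2 * pi) * s * (2 ^ 1 * s ^ (2 * 1 + 1) * fact 1 * sqrt (2 / pi))
        = sqrt (2 * pi) * sqrt (2 / pi) * (2 * (s\<^sup>2)\<^sup>2)"
      by (simp add: power2_eq_square numeral_3_eq_3)
    ultimately have "sqrt (2 * pi) * s * (2 ^ 1 * s ^ (2 * 1 + 1) * fact 1 * sqrt (2 / pi))
        = 2 * (2 * (s\<^sup>2)\<^sup>2)"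
      by (simp only:)
    also have "\<dots> = 1 / \<alpha>\<^sup>2" using s(2) by (simp add: power2_eq_square)
    finally show ?thesis .
  qed
  ultimately show ?thesis by (simp only:)
qed

lemma norm_power_diff_le_sum:
  fixes z w :: complex
  assumes "cmod z \<le> a" "cmod w \<le> b"
  shows "cmod (z ^ n - w ^ n) \<le> cmod (z - w) * (\<Sum>j<n. a ^ j * b ^ (n - Suc j))"
proof -
  have "cmod (\<Sum>j<n. w ^ (n - Suc j) * z ^ j) \<le> (\<Sum>j<n. a ^ j * b ^ (n - Suc j))"
    using assms order_trans[OF norm_ge_zero assms(1)]
    by (intro sum_norm_le) (auto simp: norm_mult norm_power mult.commute intro!: mult_mono power_mono)
  then show ?thesis
    unfolding power_diff_sumr2 norm_mult by (intro mult_left_mono) auto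
qed

text \<open>
  The midpoint rule underestimates the convex function \<open>1 / x\<^sup>2\<close>: each term is at most
  \<open>1 / ((x - d/2) (x + d/2))\<close>, and these telescope by partial fractions.
\<close>

lemma sum_inverse_square_arith_le:
  fixes c d :: real
  assumes "0 < d" "0 < c - d / 2"
  shows "(\<Sum>j<n. 1 / (c + d * real j)\<^sup>2) \<le> real n / ((c - d / 2) * (c + d * real n - d / 2))"
proof -
  define g where "g j = 1 / d * (1 / (c + d * real j - d / 2))" for j :: nat
  have pos: "0 < c + d * real j - d / 2" for j
    using assms mult_nonneg_nonneg[of d "real j"] by linarith
  have "(\<Sum>j<n. 1 / (c + d * real j)\<^sup>2) \<le> (\<Sum>j<n. g j - g (Suc j))"
  proof (rule sum_mono)
    fix j
    define x where "x = c + d * real j"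
    have x: "0 < x - d / 2" "0 < x + d / 2" using pos[of j] assms by (auto simp: x_def)
    have "1 / x\<^sup>2 \<le> 1 / ((x - d / 2) * (x + d / 2))"
      using x by (intro divide_left_mono mult_pos_pos) (auto simp: power2_eq_square algebra_simps)
    also have "\<dots> = 1 / d * (1 / (x - d / 2)) - 1 / d * (1 / (x + d / 2))"
    proof -
      have "1 / (x - d / 2) - 1 / (x + d / 2) = d / ((x - d / 2) * (x + d / 2))"
        using x by (subst diff_frac_eq) auto
      then show ?thesis using assms unfolding right_diff_distrib[symmetric] by simp
    qed
    also have "x + d / 2 = c + d * real (Suc j) - d / 2" by (simp add: x_def algebra_simps)
    finally show "1 / (c + d * real j)\<^sup>2 \<le> g j - g (Suc j)" by (simp add: g_def x_def)
  qed
  also have "\<dots> = g 0 - g n" by (rule sum_lessThan_telescope')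
  also have "\<dots> = real n / ((c - d / 2) * (c + d * real n - d / 2))"
  proof -
    have "1 / (c - d / 2) - 1 / (c + d * real n - d / 2)
        = d * real n / ((c - d / 2) * (c + d * real n - d / 2))"
      using assms pos[of n] by (subst diff_frac_eq) auto
    then show ?thesis using assms unfolding g_def right_diff_distrib[symmetric] by simp
  qed
  finally show ?thesis .
qed

text \<open>
  Inside \<open>[- \<pi>, \<pi>]\<close> the difference of the two \<open>n\<close>-th powers is telescoped, so the slow decay of the
  characteristic function occurs only to the power \<open>n - 1 - j\<close> and the fast decay of the Gaussian to
  the power \<open>j\<close>; the combined rates form an arithmetic progression. Using the slow rate throughout
  would cost a constant above \<open>0.516\<close>. Outside, only the Gaussian remains, and
  \<open>1 \<le> \<bar>t\<bar>\<^sup>3 / 27\<close> turns it into the same kind of integral.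
\<close>

lemma abs_local_error_le_decay_sum:
  fixes p :: real and n k :: nat
  assumes "0 < p" "p < 1" "n \<ge> 2" "k \<le> n"
  defines "v \<equiv> p * (1 - p)"
  shows "2 * pi * \<bar>local_error n k p\<bar>
    \<le> 11 / (60 * v) * (\<Sum>j<n. 1 / (real (n - 1) / 5 + 3 / 10 * real j)\<^sup>2)
      + 4 / (27 * (binom_sd n p)^4)"
proof -
  define s where "s = binom_sd n p"
  define y where "y = real k - real n * p"
  define f where "f t = centered_char p t" for t
  define g where "g t = complex_of_real (exp (- (v / 2) * t\<^sup>2))" for t
  define \<alpha> where "\<alpha> j = v * (real (n - 1) / 5 + 3 / 10 * real j)" for j
  have v: "v > 0" using assms by (simp add: v_def)
  have s: "s > 0" "s\<^sup>2 = real n * v" using assms by (auto simp: s_def v_def binom_sd_def)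
  have \<alpha>: "\<alpha> j > 0" for j
    unfolding \<alpha>_def using v assms(3) by (intro mult_pos_pos add_pos_nonneg) auto
  have g_power: "g t ^ n = of_real (exp (- (s\<^sup>2 / 2) * t\<^sup>2))" for t
  proof -
    have "exp (- (v / 2) * t\<^sup>2) ^ n = exp (real n * (- (v / 2) * t\<^sup>2))" by (rule exp_of_nat_mult[symmetric])
    also have "real n * (- (v / 2) * t\<^sup>2) = - (s\<^sup>2 / 2) * t\<^sup>2" by (simp add: s)
    finally show ?thesis by (simp add: g_def flip: of_real_power)
  qed
  define G where "G t = indicator {- pi..pi} t *\<^sub>R (f t ^ n * iexp (- (t * y))) - g t ^ n * iexp (- (t * y))" for t
  define B where "B t = 11 / 60 * v * (\<Sum>j<n. \<bar>t\<bar> ^ 3 * exp (- \<alpha> j * t\<^sup>2))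
      + 1 / 27 * (\<bar>t\<bar> ^ 3 * exp (- (s\<^sup>2 / 2) * t\<^sup>2))" for t
  have G: "has_bochner_integral lborel G (of_real (2 * pi * local_error n k p))"
  proof -
    have "has_bochner_integral lborel G (of_real (2 * pi * binom_prob n p k)
        - of_real (2 * pi * (1 / s * std_normal_density (y / s))))"
      unfolding G_def f_def g_power y_def
      using binom_prob_fourier_inversion[OF assms(4)] normal_density_fourier_inversion[OF s(1)]
      by (rule has_bochner_integral_diff)
    then show ?thesis by (simp add: local_error_def s_def y_def right_diff_distrib)
  qed
  have B: "has_bochner_integral lborel B
      (11 / 60 * v * (\<Sum>j<n. 1 / (\<alpha> j)\<^sup>2) + 1 / 27 * (1 / (s\<^sup>2 / 2)\<^sup>2))"
    unfolding B_def using s(1)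
    by (intro has_bochner_integral_add has_bochner_integral_mult_right has_bochner_integral_sum
        has_bochner_integral_abs_cube_gaussian \<alpha>) auto
  have pointwise: "norm (G t) \<le> B t" for t
  proof (cases "\<bar>t\<bar> \<le> pi")
    case True
    (* The Gaussian is taken as the first factor, so that the rates increase with j. *)
    have decay: "exp (- (v / 2) * t\<^sup>2) ^ j * exp (- (v / 5) * t\<^sup>2) ^ (n - Suc j) = exp (- \<alpha> j * t\<^sup>2)"
      if "j < n" for j
    proof -
      have "real (n - 1) = real j + real (n - Suc j)" using that by linarith
      then have "real j * (- (v / 2) * t\<^sup>2) + real (n - Suc j) * (- (v / 5) * t\<^sup>2) = - \<alpha> j * t\<^sup>2"
        unfolding \<alpha>_def by (simp only:) (simp add: algebra_simps)
      then show ?thesis by (simp only: exp_of_nat_mult[symmetric] exp_add[symmetric])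
    qed
    have "G t = - ((g t ^ n - f t ^ n) * iexp (- (t * y)))"
      using True by (simp add: G_def indicator_def abs_le_iff algebra_simps)
    then have "norm (G t) = cmod (g t ^ n - f t ^ n)"
      by (simp add: norm_mult)
    also have "\<dots> \<le> cmod (g t - f t) * (\<Sum>j<n. exp (- (v / 2) * t\<^sup>2) ^ j * exp (- (v / 5) * t\<^sup>2) ^ (n - Suc j))"
      using norm_centered_char_le[OF assms(1,2) True]
      by (intro norm_power_diff_le_sum) (auto simp: f_def g_def v_def)
    also have "\<dots> \<le> (11 / 60 * v * \<bar>t\<bar> ^ 3) * (\<Sum>j<n. exp (- \<alpha> j * t\<^sup>2))"
    proof (rule mult_mono)
      show "cmod (g t - f t) \<le> 11 / 60 * v * \<bar>t\<bar> ^ 3"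
        using centered_char_gaussian_distance[OF assms(1,2) True]
        by (simp add: f_def g_def v_def norm_minus_commute)
      show "(\<Sum>j<n. exp (- (v / 2) * t\<^sup>2) ^ j * exp (- (v / 5) * t\<^sup>2) ^ (n - Suc j))
          \<le> (\<Sum>j<n. exp (- \<alpha> j * t\<^sup>2))"
        by (intro sum_mono eq_refl decay) simp
    qed (use v in \<open>auto intro!: sum_nonneg\<close>)
    also have "\<dots> \<le> B t"
      by (simp add: B_def sum_distrib_left mult.assoc)
    finally show ?thesis .
  next
    case False
    then have "norm (G t) = 1 * exp (- (s\<^sup>2 / 2) * t\<^sup>2)"
      by (auto simp: G_def g_power norm_mult indicator_def abs_le_iff)
    also have "\<dots> \<le> (1 / 27 * \<bar>t\<bar> ^ 3) * exp (- (s\<^sup>2 / 2) * t\<^sup>2)"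
    proof (rule mult_right_mono)
      have "3 ^ 3 \<le> \<bar>t\<bar> ^ 3" using False pi_gt3 by (intro power_mono) auto
      then show "1 \<le> 1 / 27 * \<bar>t\<bar> ^ 3" by simp
    qed auto
    also have "\<dots> \<le> B t"
      unfolding B_def using v by (auto intro!: mult_nonneg_nonneg sum_nonneg)
    finally show ?thesis .
  qed
  have "2 * pi * \<bar>local_error n k p\<bar> = norm (integral\<^sup>L lborel G)"
    using has_bochner_integral_integral_eq[OF G] by (simp add: norm_mult abs_mult)
  also have "\<dots> \<le> integral\<^sup>L lborel B"
    by (rule Bochner_Integration.integral_norm_bound_integral[OF integrable.intros[OF G]
          integrable.intros[OF B] pointwise])
  also have "\<dots> = 11 / 60 * v * (\<Sum>j<n. 1 / (\<alpha> j)\<^sup>2) + 1 / 27 * (1 / (s\<^sup>2 / 2)\<^sup>2)"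
    using B by (rule has_bochner_integral_integral_eq)
  also have "11 / 60 * v * (\<Sum>j<n. 1 / (\<alpha> j)\<^sup>2)
      = 11 / (60 * v) * (\<Sum>j<n. 1 / (real (n - 1) / 5 + 3 / 10 * real j)\<^sup>2)"
  proof -
    have "11 / 60 * v * (1 / (\<alpha> j)\<^sup>2) = 11 / (60 * v) * (1 / (real (n - 1) / 5 + 3 / 10 * real j)\<^sup>2)" for j
      using v unfolding \<alpha>_def by (simp add: power_mult_distrib) (simp add: power2_eq_square)
    then show ?thesis by (simp only: sum_distrib_left)
  qed
  also have "1 / 27 * (1 / (s\<^sup>2 / 2)\<^sup>2) = 4 / (27 * s ^ 4)"
  proof -
    have "(s\<^sup>2 / 2)\<^sup>2 = s ^ 4 / 4" by (simp only: power_divide power_mult[symmetric]) simp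
    then show ?thesis by (simp only:) simp
  qed
  finally show ?thesis by (simp only: s_def)
qed

text \<open>
  Since \<open>p (1 - p) \<le> 1/4\<close>, a variance of at least \<open>36/25\<close> forces \<open>n \<ge> 6\<close>, so that the loss in the
  telescoped sum is bounded. With \<open>3 \<le> \<pi>\<close> the resulting constant is below \<open>(2.94 + 0.11) / 6 < 0.51\<close>.
\<close>

lemma abs_local_error_less_variance_bound:
  assumes "0 < p" "p < 1" "k \<le> n" "36 / 25 \<le> (binom_sd n p)\<^sup>2"
  shows "\<bar>local_error n k p\<bar> < 0.516 / (binom_sd n p)\<^sup>2"
proof -
  define v where "v = p * (1 - p)"
  define S where "S = (binom_sd n p)\<^sup>2"
  have v: "v > 0" "v \<le> 1 / 4"
    using assms bernoulli_variance_le_quarter[of p] by (auto simp: v_def)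
  have S: "S = real n * v" using assms by (simp add: S_def v_def binom_sd_def)
  have S_ge: "S \<ge> 36 / 25" using assms by (simp add: S_def)
  have "real n * v \<le> real n * (1 / 4)" using v by (intro mult_left_mono) auto
  then have "real n > 5" using S S_ge by linarith
  then have n: "n \<ge> 6" by linarith
  have "(\<Sum>j<n. 1 / (real (n - 1) / 5 + 3 / 10 * real j)\<^sup>2)
      \<le> real n / ((real (n - 1) / 5 - 3 / 10 / 2) * (real (n - 1) / 5 + 3 / 10 * real n - 3 / 10 / 2))"
    using n by (intro sum_inverse_square_arith_le) auto
  also have "(real (n - 1) / 5 - 3 / 10 / 2) * (real (n - 1) / 5 + 3 / 10 * real n - 3 / 10 / 2)
      = (real n - 7 / 4) * (real n - 7 / 10) / 10"
    using n by (simp add: of_nat_diff field_simps)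
  also have "real n / \<dots> \<le> 16 / real n"
  proof -
    (* After clearing denominators, the difference of the two sides is this product up to a
       positive factor and a positive additive constant; n \<ge> 6 enters here. *)
    have "0 \<le> (real n - 6) * (30 * real n - 16)" using n by (intro mult_nonneg_nonneg) auto
    also have "\<dots> = 5 * (16 * ((real n - 7 / 4) * (real n - 7 / 10)) - 10 * (real n * real n)) - 2"
      by (simp add: algebra_simps)
    finally have "0 \<le> 16 * ((real n - 7 / 4) * (real n - 7 / 10)) - 10 * (real n * real n)"
      by simp
    then show ?thesis using n by (simp add: divide_simps)
  qed
  finally have sum: "(\<Sum>j<n. 1 / (real (n - 1) / 5 + 3 / 10 * real j)\<^sup>2) \<le> 16 / real n" .
  have "2 * pi * \<bar>local_error n k p\<bar>
      \<le> 11 / (60 * v) * (\<Sum>j<n. 1 / (real (n - 1) / 5 + 3 / 10 * real j)\<^sup>2) + 4 / (27 * (binom_sd n p) ^ 4)"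
    using abs_local_error_le_decay_sum[of p n k] assms n by (simp add: v_def)
  also have "\<dots> \<le> 11 / (60 * v) * (16 / real n) + 4 / (27 * ((36 / 25) * S))"
  proof (intro add_mono mult_left_mono sum)
    have "(binom_sd n p) ^ 4 = S * S"
      by (simp add: S_def power4_eq_xxxx power2_eq_square mult.assoc)
    moreover have "4 / (27 * (S * S)) \<le> 4 / (27 * ((36 / 25) * S))"
      using S_ge by (intro frac_le mult_left_mono mult_right_mono) simp_all
    ultimately show "4 / (27 * (binom_sd n p) ^ 4) \<le> 4 / (27 * ((36 / 25) * S))"
      by (simp only:)
    show "0 \<le> 11 / (60 * v)" using v(1) by simp
  qed
  also have "\<dots> = (176 / 60 + 4 / (27 * (36 / 25))) / S"
  proof -
    have "11 / (60 * v) * (16 / real n) = 176 / 60 / S" by (simp add: S)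
    moreover have "4 / (27 * ((36 / 25) * S)) = 4 / (27 * (36 / 25)) / S" by simp
    ultimately show ?thesis by (simp only: add_divide_distrib)
  qed
  also have "\<dots> < 6 * (0.516 / S)"
  proof -
    have "(176 / 60 + 4 / (27 * (36 / 25))) / S < 6 * 0.516 / S"
      using S_ge by (intro divide_strict_right_mono) simp_all
    then show ?thesis by (simp only: times_divide_eq_right)
  qed
  also have "\<dots> \<le> 2 * pi * (0.516 / S)"
  proof (rule mult_right_mono)
    show "6 \<le> 2 * pi" using pi_gt3 by simp
    show "0 \<le> 0.516 / S" using S_ge by (intro divide_nonneg_nonneg) simp_all
  qed
  finally have "\<bar>local_error n k p\<bar> < 0.516 / S"
    by (rule mult_left_less_imp_less) simp
  then show ?thesis by (simp only: S_def)
qed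

theorem lemma5:
  fixes p :: real and n k :: nat
  assumes "0 < p" and "p < 1"
    and "n \<ge> 1" and "k \<le> n"
  shows "\<bar>local_error n k p\<bar>
           < min (1 / (binom_sd n p * sqrt (2 * exp 1))) (0.516 / (binom_sd n p)\<^sup>2)"
proof -
  define s where "s = binom_sd n p"
  have s: "s > 0" using assms by (simp add: s_def binom_sd_def)
  have sd_bound: "\<bar>local_error n k p\<bar> < 1 / (s * sqrt (2 * exp 1))"
    using abs_local_error_less_sd_bound[OF assms] by (simp add: s_def)
  have var_bound: "\<bar>local_error n k p\<bar> < 0.516 / s\<^sup>2"
  (* The two bounds coincide at this value of s, and below it the first one is the smaller. *)
  proof (cases "s \<le> 0.516 * sqrt (2 * exp 1)")
    case True
    have "1 / (s * sqrt (2 * exp 1)) = s / (s\<^sup>2 * sqrt (2 * exp 1))"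
      using s by (simp add: power2_eq_square)
    also have "\<dots> \<le> 0.516 * sqrt (2 * exp 1) / (s\<^sup>2 * sqrt (2 * exp 1))"
      using True s by (intro divide_right_mono) auto
    also have "\<dots> = 0.516 / s\<^sup>2" by simp
    finally show ?thesis using sd_bound by linarith
  next
    case False
    (* This lower bound for e makes the square of the threshold exceed 36/25. *)
    have "2.71 \<le> exp (1 :: real)"
    proof -
      have "(1.105 :: real) \<le> exp (1 / 10)"
        using exp_lower_Taylor_quadratic[of "1 / 10 :: real"] by (simp add: power2_eq_square)
      then have "(1.105 :: real) ^ 10 \<le> exp (1 / 10) ^ 10" by (intro power_mono) simp_all
      also have "exp (1 / 10) ^ 10 = exp (real 10 * (1 / 10))" by (rule exp_of_nat_mult[symmetric])
      also have "real 10 * (1 / 10) = 1" by simp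
      finally have "(1.105 :: real) ^ 10 \<le> exp 1" .
      moreover have "2.71 \<le> (1.105 :: real) ^ 10" by (simp add: power_divide)
      ultimately show ?thesis by (rule order_trans[rotated])
    qed
    then have "36 / 25 \<le> 0.516\<^sup>2 * (2 * exp (1 :: real))" by (simp add: power2_eq_square)
    also have "\<dots> = (0.516 * sqrt (2 * exp 1))\<^sup>2"
      by (simp only: power_mult_distrib) simp
    also have "\<dots> \<le> s\<^sup>2"
      using False by (intro power_mono) simp_all
    finally have "36 / 25 \<le> s\<^sup>2" .
    then show ?thesis
      using abs_local_error_less_variance_bound[OF assms(1,2,4)] by (simp only: s_def)
  qed
  show ?thesis using sd_bound var_bound by (simp add: s_def)
qed

end
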